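(* Let $A\in\mathbb{C}^{m\times n}$ and $b\in\mathbb{C}^m$ be such that the linear system $Ax=b$ is consistent. Let $\{x_k\}_{k=0}^\infty$ be the iteration sequence generated by the GK method (defined in the context), starting from an initial guess $x_0\in\mathbb{C}^n$ in the column space of $A^{*}$, with associated index sets $\mathcal{R}_k$. Then $\{x_k\}_{k=0}^\infty$ converges linearly to the least-Euclidean-norm solution $x_\star=A^{\dagger}b$, and $$\|x_1-x_\star\|_2^2\le\left(1-\frac{1}{|\mathcal{R}_0|}\cdot\frac{1}{\sum_{i\in\mathcal{R}_0}\|A^{(i)}\|_2^2}\cdot\frac1m\cdot\lambda_{\min}(A^{*}A)\right)\|x_0-x_\star\|_2^2,$$ and, for $k=1,2,\ldots$, $$\|x_{k+1}-x_\star\|_2^2\le\left(1-\frac{1}{|\mathcal{R}_k|}\cdot\frac{1}{\sum_{i\in\mathcal{R}_k}\|A^{(i)}\|_2^2}\cdot\frac{1}{m-1}\cdot\lambda_{\min}(A^{*}A)\right)\|x_k-x_\star\|_2^2.$$ Moreover, let $\alpha=\max_{k\ge 0}|\mathcal{R}_k|$ and $\beta=\max_{k\ge 0}\sum_{i\in\mathcal{R}_k}\|A^{(i)}\|_2^2$. Then, for $k=1,2,\ldots$, $$\|x_k-x_\star\|_2^2\le\left(1-\frac{\lambda_{\min}(A^{*}A)}{\alpha\cdot\beta\cdot(m-1)}\right)^{k-1}\left(1-\frac{\lambda_{\min}(A^{*}A)}{|\mathcal{R}_0|\cdot\sum_{i\in\mathcal{R}_0}\|A^{(i)}\|_2^2\cdot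 m}\right)\|x_0-x_\star\|_2^2.$$
   Context: Notation: for a vector $z$, $z^{(j)}$ is its $j$th entry; for a matrix $A$, $A^{(i)}$ is its $i$th row (a row vector); $(\cdot)^{*}$ is the conjugate transpose; $A^{\dagger}$ is the Moore-Penrose pseudoinverse; $\lambda_{\min}(A^{*}A)$ denotes the smallest positive eigenvalue of $A^{*}A$; $|\mathcal{W}|$ is the number of elements of a set $\mathcal{W}$. GK (greedy Kaczmarz) method: given $A\in\mathbb{C}^{m\times n}$, $b\in\mathbb{C}^m$ and an initial estimate $x_0\in\mathbb{C}^n$, for $k=0,1,2,\ldots$ let $r_k=b-Ax_k$ be the residual and do the following. (1) Determine the index set of all indices where the residual entry has maximal modulus: $$\mathcal{R}_k=\left\{\tilde i_k\in\{1,\ldots,m\} : |r_k^{(\tilde i_k)}|=\max_{1\le i\le m}|r_k^{(i)}|\right\}.$$ (2) Choose $$i_k=\arg\max_{\tilde i_k\in\mathcal{R}_k}\left\{\frac{|r_k^{(\tilde i_k)}|^2}{\|A^{(\tilde i_k)}\|_2^2}\right\},$$ i.e. an index $i_k \in \mathcal{R}_k$ attaining this maximum. (3) Set $$x_{k+1}=x_k+\frac{r_k^{(i_k)}}{\|A^{(i_k)}\|_2^2}\,(A^{(i_k)})^{*}.$$ *)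

theory Defs
  imports "HOL-Analysis.Analysis"
begin

definition conj_transpose :: "complex^'n^'m \<Rightarrow> complex^'m^'n" where
  "conj_transpose A = (\<chi> j i. cnj (A $ i $ j))"

(* The four Penrose conditions. *)
definition is_pseudoinverse :: "complex^'n^'m \<Rightarrow> complex^'m^'n \<Rightarrow> bool" where
  "is_pseudoinverse A X \<longleftrightarrow>
     A ** X ** A = A \<and>
     X ** A ** X = X \<and>
     conj_transpose (A ** X) = A ** X \<and>
     conj_transpose (X ** A) = X ** A"

definition pseudoinverse :: "complex^'n^'m \<Rightarrow> complex^'m^'n" where
  "pseudoinverse A = (THE X. is_pseudoinverse A X)"

definition eigenvalue :: "complex^'n^'n \<Rightarrow> complex \<Rightarrow> bool" where
  "eigenvalue M c \<longleftrightarrow> (\<exists>v. v \<noteq> 0 \<and> M *v v = c *s v)"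

(* The smallest positive eigenvalue; unspecified if M has none
   (for M = A\<^sup>*A this happens only if A = 0). *)
definition lambda_min :: "complex^'n^'n \<Rightarrow> real" where
  "lambda_min M = Min {t. t > 0 \<and> eigenvalue M (complex_of_real t)}"

definition residual :: "complex^'n^'m \<Rightarrow> complex^'m \<Rightarrow> complex^'n \<Rightarrow> complex^'m" where
  "residual A b x = b - A *v x"

definition max_residual_set :: "complex^'n^'m \<Rightarrow> complex^'m \<Rightarrow> complex^'n \<Rightarrow> 'm set" where
  "max_residual_set A b x =
     {i. cmod (residual A b x $ i) = Max (range (\<lambda>j. cmod (residual A b x $ j)))}"

(* x is a GK iteration sequence whose k-th selected row is idx k. The method leaves ties in
   the choice of the row unresolved, hence a predicate. Division by a zero row norm
   yields 0; for a consistent system a zero row can be selected only when the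
   residual vanishes, and then the iterate does not change. *)
definition GK_iteration ::
  "complex^'n^'m \<Rightarrow> complex^'m \<Rightarrow> (nat \<Rightarrow> complex^'n) \<Rightarrow> (nat \<Rightarrow> 'm) \<Rightarrow> bool" where
  "GK_iteration A b x idx \<longleftrightarrow>
     (\<forall>k. is_arg_max (\<lambda>i. (cmod (residual A b (x k) $ i))\<^sup>2 / (norm (row i A))\<^sup>2)
            (\<lambda>i. i \<in> max_residual_set A b (x k)) (idx k) \<and>
          x (Suc k) = x k +
            (residual A b (x k) $ idx k / complex_of_real ((norm (row (idx k) A))\<^sup>2))
              *s (\<chi> j. cnj (row (idx k) A $ j)))"

(* Q-linear convergence with a uniform rate; the division-free form also covers
   sequences that reach the limit in finitely many steps. *)
definition converges_linearly :: "(nat \<Rightarrow> 'a::real_normed_vector) \<Rightarrow> 'a \<Rightarrow> bool" where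
  "converges_linearly x l \<longleftrightarrow>
     x \<longlonglongrightarrow> l \<and>
     (\<exists>\<rho>. 0 \<le> \<rho> \<and> \<rho> < 1 \<and> (\<forall>k. norm (x (Suc k) - l) \<le> \<rho> * norm (x k - l)))"

end

theory Submission
  imports Defs
begin

text \<open>
  A step of the method is the orthogonal projection onto the hyperplane of the selected equation,
  so the squared error drops by \<open>|r\<^sub>i|\<^sup>2 / \<parallel>A\<^sub>i\<parallel>\<^sup>2\<close>. Since \<open>|r\<^sub>i|\<close> is maximal, \<open>|r\<^sub>i|\<^sup>2\<close> is at least
  \<open>\<parallel>r\<parallel>\<^sup>2 / m\<close>, and from the second step on at least \<open>\<parallel>r\<parallel>\<^sup>2 / (m - 1)\<close>, because the equation
  selected in the previous step is satisfied exactly. The error stays in the column space of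
  \<open>A\<^sup>*\<close>, where \<open>\<parallel>r\<parallel>\<^sup>2 = \<parallel>A e\<parallel>\<^sup>2 \<ge> \<lambda>\<^sub>m\<^sub>i\<^sub>n \<parallel>e\<parallel>\<^sup>2\<close>.
\<close>

section \<open>Conjugate transposes\<close>

lemma conj_transpose_conj_transpose [simp]: "conj_transpose (conj_transpose A) = A"
  by (simp add: conj_transpose_def vec_eq_iff)

lemma conj_transpose_mult: "conj_transpose (A ** B) = conj_transpose B ** conj_transpose A"
  by (simp add: conj_transpose_def matrix_matrix_mult_def vec_eq_iff mult.commute)

lemma linear_complex_matrix_vector_mult:
  fixes A :: "complex^'n^'m"
  shows "linear (\<lambda>v. A *v v)"
  by (rule linearI)
     (simp_all add: vec_eq_iff matrix_vector_mult_def distrib_left sum.distrib scaleR_sum_right)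

lemma of_real_vector_scalar_mult: "complex_of_real t *s v = t *\<^sub>R v"
  by (simp add: vec_eq_iff scaleR_conv_of_real[where 'a = complex])

text \<open>\<open>inner\<close> is the real part of the Hermitian product; the adjoint relation
  survives, so real inner-product arguments apply to complex vectors.\<close>

lemma inner_matrix_vector_mult:
  fixes A :: "complex^'n^'m"
  shows "inner (A *v v) w = inner v (conj_transpose A *v w)"
proof -
  have "inner (A *v v) w = (\<Sum>i\<in>UNIV. \<Sum>j\<in>UNIV. inner (A $ i $ j * v $ j) (w $ i))"
    by (simp add: inner_vec_def matrix_vector_mult_def inner_sum_left)
  also have "\<dots> = (\<Sum>j\<in>UNIV. \<Sum>i\<in>UNIV. inner (v $ j) (cnj (A $ i $ j) * w $ i))"
    by (subst sum.swap) (simp add: inner_complex_def algebra_simps)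
  also have "\<dots> = inner v (conj_transpose A *v w)"
    by (simp add: inner_vec_def matrix_vector_mult_def inner_sum_right conj_transpose_def)
  finally show ?thesis .
qed

text \<open>Pairing the hypothesis with \<open>v\<close> gives
  \<open>inner (A *v v) (A *v v) = 0\<close>.\<close>

lemma gram_vector_eq_0_imp:
  fixes A :: "complex^'n^'m"
  assumes "conj_transpose A *v (A *v v) = 0"
  shows "A *v v = 0"
  using inner_matrix_vector_mult[of A v "A *v v"] assms by simp

lemma gram_cancel_left:
  fixes A :: "complex^'n^'m" and C D :: "complex^'k^'n"
  assumes "conj_transpose A ** A ** C = conj_transpose A ** A ** D"
  shows "A ** C = A ** D"
proof -
  have "A *v (C *v v) = A *v (D *v v)" for v
  proof -
    have "conj_transpose A *v (A *v (C *v v)) = conj_transpose A *v (A *v (D *v v))"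
      using assms by (simp add: matrix_vector_mul_assoc matrix_mul_assoc)
    hence "conj_transpose A *v (A *v (C *v v - D *v v)) = 0"
      by (simp add: matrix_vector_mult_diff_distrib)
    hence "A *v (C *v v - D *v v) = 0"
      by (rule gram_vector_eq_0_imp)
    thus ?thesis by (simp add: matrix_vector_mult_diff_distrib)
  qed
  thus ?thesis by (simp add: matrix_eq matrix_vector_mul_assoc[symmetric])
qed

text \<open>The adjoint of \<open>gram_cancel_left\<close>, applied to
  \<open>conj_transpose A\<close>.\<close>

lemma gram_cancel_right:
  fixes A :: "complex^'n^'m" and P Q :: "complex^'m^'k"
  assumes "P ** A ** conj_transpose A = Q ** A ** conj_transpose A"
  shows "P ** A = Q ** A"
proof -
  let ?B = "conj_transpose A"
  have "conj_transpose (P ** A ** ?B) = conj_transpose (Q ** A ** ?B)"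
    using assms by simp
  hence "conj_transpose ?B ** ?B ** conj_transpose P = conj_transpose ?B ** ?B ** conj_transpose Q"
    by (simp add: conj_transpose_mult matrix_mul_assoc)
  hence "?B ** conj_transpose P = ?B ** conj_transpose Q"
    by (rule gram_cancel_left)
  hence "conj_transpose (P ** A) = conj_transpose (Q ** A)"
    by (simp add: conj_transpose_mult)
  thus ?thesis by (metis conj_transpose_conj_transpose)
qed

section \<open>The Moore-Penrose pseudoinverse\<close>

text \<open>The matrix of a linear right inverse of \<open>B\<close> on its range serves as
  \<open>Y\<close>.\<close>

lemma generalized_inverse_exists:
  fixes B :: "complex^'n^'m"
  shows "\<exists>Y :: complex^'m^'n. B ** Y ** B = B"
proof -
  obtain g where g: "Vector_Spaces.linear (*s) (*s) g" "\<forall>v\<in>range ((*v) B). B *v (g v) = v"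
    using vec.linear_exists_right_inverse_on[OF matrix_vector_mul_linear_gen[of B] vec.subspace_UNIV]
    by blast
  have "B ** matrix g ** B = B"
    using g by (simp add: matrix_eq matrix_vector_mul_assoc[symmetric] matrix_works)
  thus ?thesis ..
qed

text \<open>\<open>A ** X\<close> and \<open>A ** Y\<close> are both the orthogonal projection onto
  the range of \<open>A\<close>, hence equal; \<open>X ** A\<close> and \<open>Y ** A\<close> agree
  in the same way.\<close>

lemma is_pseudoinverse_unique:
  assumes X: "is_pseudoinverse A X" and Y: "is_pseudoinverse A Y"
  shows "X = Y"
proof -
  note PX = X[unfolded is_pseudoinverse_def] and PY = Y[unfolded is_pseudoinverse_def]
  have "A ** X = (A ** Y) ** (A ** X)"
    using PY by (simp add: matrix_mul_assoc)
  also have "\<dots> = conj_transpose ((A ** X) ** (A ** Y))"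
    using PX PY by (simp add: conj_transpose_mult)
  also have "\<dots> = A ** Y"
    using PX PY by (simp add: matrix_mul_assoc)
  finally have AX: "A ** X = A ** Y" .
  have "X ** A = (X ** A) ** (Y ** A)"
    using PY by (metis matrix_mul_assoc)
  also have "\<dots> = conj_transpose ((Y ** A) ** (X ** A))"
    using PX PY by (simp add: conj_transpose_mult)
  also have "\<dots> = Y ** A"
    using PX PY by (metis matrix_mul_assoc)
  finally have XA: "X ** A = Y ** A" .
  have "X = X ** A ** Y"
    using PX AX by (metis matrix_mul_assoc)
  thus ?thesis using PY XA by simp
qed

text \<open>Any generalized inverse \<open>Y\<close> of \<open>A\<^sup>* A A\<^sup>*\<close> gives the pseudoinverse as \<open>A\<^sup>* Y A\<^sup>*\<close>.\<close>

lemma is_pseudoinverse_exists: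
  fixes A :: "complex^'n^'m"
  shows "\<exists>X. is_pseudoinverse A X"
proof -
  let ?B = "conj_transpose A"
  obtain Y where Y: "(?B ** A ** ?B) ** Y ** (?B ** A ** ?B) = ?B ** A ** ?B"
    using generalized_inverse_exists by blast
  define X where "X = ?B ** Y ** ?B"
  have "?B ** A ** ?B ** Y ** ?B ** A ** ?B = ?B ** A ** ?B"
    using Y by (simp add: matrix_mul_assoc)
  hence "(?B ** A ** ?B ** Y ** ?B) ** A = ?B ** A"
    by (rule gram_cancel_right)
  \<comment> \<open>The factor \<open>mat 1\<close> gives the equation the shape of
    \<open>gram_cancel_right\<close>, with \<open>?B\<close> in the role of
    \<open>A\<close>.\<close>
  hence "(?B ** A ** ?B ** Y) ** ?B ** conj_transpose ?B = mat 1 ** ?B ** conj_transpose ?B"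
    by (simp add: matrix_mul_lid)
  from gram_cancel_right[OF this] have BAX: "?B ** A ** X = ?B"
    by (simp add: X_def matrix_mul_lid matrix_mul_assoc)
  have "?B ** A ** (?B ** Y ** ?B ** A ** ?B) = ?B ** A ** ?B"
    using Y by (simp add: matrix_mul_assoc)
  hence "A ** (?B ** Y ** ?B ** A ** ?B) = A ** ?B"
    by (rule gram_cancel_left)
  hence "conj_transpose ?B ** ?B ** (Y ** ?B ** A ** ?B) = conj_transpose ?B ** ?B ** mat 1"
    by (simp add: matrix_mul_rid matrix_mul_assoc)
  from gram_cancel_left[OF this] have XAB: "X ** A ** ?B = ?B"
    by (simp add: X_def matrix_mul_rid matrix_mul_assoc)
  \<comment> \<open>The left side is self-adjoint, so \<open>conj_transpose (A ** X)\<close> is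
    self-adjoint and equals \<open>A ** X\<close>.\<close>
  have AX: "conj_transpose (A ** X) ** (A ** X) = conj_transpose (A ** X)"
    using BAX by (metis conj_transpose_mult matrix_mul_assoc)
  hence hAX: "conj_transpose (A ** X) = A ** X"
    by (metis conj_transpose_mult conj_transpose_conj_transpose)
  have XA: "(X ** A) ** conj_transpose (X ** A) = conj_transpose (X ** A)"
    using XAB by (metis conj_transpose_mult matrix_mul_assoc)
  hence hXA: "conj_transpose (X ** A) = X ** A"
    by (metis conj_transpose_mult conj_transpose_conj_transpose)
  have "X ** A ** X = X"
    using XAB unfolding X_def by (simp add: matrix_mul_assoc)
  moreover have "A ** X ** A = A"
    using XAB hXA by (metis conj_transpose_mult conj_transpose_conj_transpose matrix_mul_assoc)
  ultimately show ?thesis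
    using hAX hXA unfolding is_pseudoinverse_def by blast
qed

lemma is_pseudoinverse_pseudoinverse: "is_pseudoinverse A (pseudoinverse A)"
  unfolding pseudoinverse_def
  by (rule theI', rule ex_ex1I[OF is_pseudoinverse_exists is_pseudoinverse_unique])

lemma pseudoinverse_solves:
  assumes "A *v z = b"
  shows "A *v (pseudoinverse A *v b) = b"
  using is_pseudoinverse_pseudoinverse[of A] assms
  by (metis is_pseudoinverse_def matrix_vector_mul_assoc)

text \<open>In \<open>X = (X ** A) ** X\<close> the self-adjoint factor \<open>X ** A\<close> can be
  replaced by its adjoint, which starts with \<open>conj_transpose A\<close>.\<close>

lemma pseudoinverse_in_row_space:
  "pseudoinverse A *v b \<in> range (\<lambda>y. conj_transpose A *v y)"
proof -
  let ?X = "pseudoinverse A"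
  have "?X = conj_transpose A ** (conj_transpose ?X ** ?X)"
    using is_pseudoinverse_pseudoinverse[of A]
    by (metis is_pseudoinverse_def conj_transpose_mult matrix_mul_assoc)
  thus ?thesis by (metis rangeI matrix_vector_mul_assoc)
qed

text \<open>Two solutions differ by a kernel vector of \<open>A\<close>, which is orthogonal to the
  row space containing the pseudoinverse solution; Pythagoras then compares the norms.\<close>

lemma pseudoinverse_is_arg_min:
  fixes A :: "complex^'n^'m"
  assumes "\<exists>z. A *v z = b"
  shows "is_arg_min norm (\<lambda>z. A *v z = b) z \<longleftrightarrow> z = pseudoinverse A *v b"
proof -
  define p where "p = pseudoinverse A *v b"
  have p: "A *v p = b" using assms pseudoinverse_solves unfolding p_def by blast
  obtain y where y: "p = conj_transpose A *v y"
    using pseudoinverse_in_row_space unfolding p_def by blast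
  have pyth: "(norm w)\<^sup>2 = (norm p)\<^sup>2 + (norm (w - p))\<^sup>2" if "A *v w = b" for w
  proof -
    have "inner (w - p) p = 0"
      using that p inner_matrix_vector_mult[of A "w - p" y]
      by (simp add: y matrix_vector_mult_diff_distrib)
    thus ?thesis by (simp add: power2_norm_eq_inner inner_diff inner_commute)
  qed
  have less: "norm p < norm w" if "A *v w = b" "w \<noteq> p" for w
  proof (rule power2_less_imp_less)
    have "0 < (norm (w - p))\<^sup>2" using that by simp
    thus "(norm p)\<^sup>2 < (norm w)\<^sup>2" using pyth[OF that(1)] by linarith
  qed simp
  show ?thesis
    unfolding is_arg_min_def p_def[symmetric] using less p by (metis less_asym)
qed

section \<open>The smallest positive eigenvalue of the Gram matrix\<close>

text \<open>Eigenvectors for distinct eigenvalues are orthogonal, hence independent over the reals,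
  and the dimension is finite. This makes the \<open>Min\<close> in \<open>lambda_min\<close>
  meaningful.\<close>

lemma finite_positive_eigenvalues_gram:
  fixes A :: "complex^'n^'m"
  shows "finite {t. t > 0 \<and> eigenvalue (conj_transpose A ** A) (complex_of_real t)}"
    (is "finite ?E")
proof -
  have "\<forall>t\<in>?E. \<exists>v. v \<noteq> 0 \<and> (conj_transpose A ** A) *v v = t *\<^sub>R v"
    by (auto simp: eigenvalue_def of_real_vector_scalar_mult)
  then obtain v where v: "\<And>t. t \<in> ?E \<Longrightarrow> v t \<noteq> 0 \<and> (conj_transpose A ** A) *v v t = t *\<^sub>R v t"
    by metis
  have orth: "inner (v s) (v t) = 0" if "s \<in> ?E" "t \<in> ?E" "s \<noteq> t" for s t
  proof -
    have "s * inner (v s) (v t) = inner (A *v v s) (A *v v t)" if "s \<in> ?E" for s t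
      using v[OF that] inner_matrix_vector_mult[of A "v t" "A *v v s"]
      by (simp add: matrix_vector_mul_assoc inner_commute)
    from this[OF that(1), of t] this[OF that(2), of s]
    have "s * inner (v s) (v t) = t * inner (v s) (v t)"
      by (simp add: inner_commute)
    with that(3) show ?thesis by simp
  qed
  have inj: "inj_on v ?E"
  proof (rule inj_onI, rule ccontr)
    fix s t assume st: "s \<in> ?E" "t \<in> ?E" "v s = v t" "s \<noteq> t"
    with orth[OF st(1,2,4)] v[OF st(1)] show False by simp
  qed
  have "independent (v ` ?E)"
    by (rule pairwise_orthogonal_independent)
       (use orth v in \<open>auto simp: pairwise_def orthogonal_def image_iff\<close>)
  hence "finite (v ` ?E)" by (rule independent_imp_finite)
  thus ?thesis using inj finite_imageD by blast
qed

text \<open>A minimizer of \<open>v \<mapsto> \<parallel>A v\<parallel>\<close> on the unit sphere of the row space is an eigenvector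
  of \<open>A\<^sup>* A\<close>, and its eigenvalue is positive because \<open>A\<close> is injective there.\<close>

lemma lambda_min_gram:
  fixes A :: "complex^'n^'m"
  assumes "A \<noteq> 0"
  defines "lam \<equiv> lambda_min (conj_transpose A ** A)"
  shows "lam > 0"
    and "v \<in> range (\<lambda>y. conj_transpose A *v y) \<Longrightarrow> lam * (norm v)\<^sup>2 \<le> (norm (A *v v))\<^sup>2"
proof -
  let ?B = "conj_transpose A"
  let ?V = "range (\<lambda>y. ?B *v y)"
  have linA: "linear (\<lambda>v. A *v v)" and linB: "linear (\<lambda>v. ?B *v v)"
    by (rule linear_complex_matrix_vector_mult)+
  have subV: "subspace ?V"
    by (rule linear_subspace_image[OF linB subspace_UNIV])
  \<comment> \<open>For \<open>w = ?B *v y\<close>,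
    \<open>inner w w = inner (A *v w) y = 0\<close>.\<close>
  have inj: "w = 0" if "w \<in> ?V" "A *v w = 0" for w
    using that inner_matrix_vector_mult[of A w] by (auto simp: image_iff) (metis inner_eq_zero_iff)
  obtain w where w: "w \<in> ?V" "w \<noteq> 0"
  proof -
    have "?B \<noteq> 0"
      using assms(1) by (auto simp: conj_transpose_def vec_eq_iff)
    then obtain y where "?B *v y \<noteq> 0"
      by (metis matrix_eq matrix_vector_mult_0)
    thus ?thesis using that by blast
  qed
  let ?S = "?V \<inter> sphere 0 1"
  have "(1 / norm w) *\<^sub>R w \<in> ?S"
    using w subV by (simp add: subspace_scale)
  hence ne: "?S \<noteq> {}" by blast
  have comp: "compact ?S"
    by (simp add: closed_Int_compact closed_subspace subV)
  have cont: "continuous_on ?S (\<lambda>v. (norm (A *v v))\<^sup>2)"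
    using linear_continuous_on[OF linA[unfolded linear_conv_bounded_linear]]
    by (intro continuous_intros)
  obtain u where u: "u \<in> ?S" "\<And>z. z \<in> ?S \<Longrightarrow> (norm (A *v u))\<^sup>2 \<le> (norm (A *v z))\<^sup>2"
    using continuous_attains_inf[OF comp ne cont] by metis
  define t where "t = (norm (A *v u))\<^sup>2"
  have ray: "t * (norm z)\<^sup>2 \<le> (norm (A *v z))\<^sup>2" if "z \<in> ?V" for z
  proof (cases "z = 0")
    case False
    have "(1 / norm z) *\<^sub>R z \<in> ?S"
      using that False subV by (simp add: subspace_scale)
    from u(2)[OF this] have "t \<le> (norm (A *v z) / norm z)\<^sup>2"
      using linear_cmul[OF linA] by (simp add: t_def)
    thus ?thesis using False by (simp add: power_divide pos_le_divide_eq)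
  qed (use t_def in simp)
  have "A *v u \<noteq> 0" using inj u(1) by fastforce
  hence tpos: "t > 0" by (simp add: t_def)
  define g where "g = ?B *v (A *v u) - t *\<^sub>R u"
  have gV: "g \<in> ?V"
    unfolding g_def using u(1) subV by (intro subspace_diff subspace_scale) auto
  have "g = 0"
  proof -
    \<comment> \<open>The form \<open>(norm (A *v z))\<^sup>2 - t * (norm z)\<^sup>2\<close> is
      nonnegative on \<open>?V\<close> and vanishes at \<open>u\<close>, so its derivative there in
      direction \<open>g\<close>, which is \<open>2 * (norm g)\<^sup>2\<close>, must be 0.
      \<open>K\<close> is its value at \<open>g\<close>.\<close>
    define K where "K = (norm (A *v g))\<^sup>2 - t * (norm g)\<^sup>2"
    have K: "K \<ge> 0" using ray[OF gV] by (simp add: K_def)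
    have quad: "0 \<le> 2 * s * (norm g)\<^sup>2 + s\<^sup>2 * K" for s
    proof -
      have "u + s *\<^sub>R g \<in> ?V" using u(1) gV subV by (simp add: subspace_add subspace_scale)
      from ray[OF this] have "0 \<le> (norm (A *v (u + s *\<^sub>R g)))\<^sup>2 - t * (norm (u + s *\<^sub>R g))\<^sup>2"
        by simp
      also have "\<dots> = (norm (A *v u))\<^sup>2 + 2 * s * inner (A *v g) (A *v u) + s\<^sup>2 * (norm (A *v g))\<^sup>2
          - t * ((norm u)\<^sup>2 + 2 * s * inner g u + s\<^sup>2 * (norm g)\<^sup>2)"
        by (simp add: linear_add[OF linA] linear_cmul[OF linA] power2_norm_eq_inner
            inner_add inner_commute)
          (simp add: power2_eq_square algebra_simps)
      also have "\<dots> = 2 * s * (inner g (?B *v (A *v u)) - t * inner g u) + s\<^sup>2 * K"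
        using u(1) by (simp add: inner_matrix_vector_mult t_def K_def algebra_simps)
      also have "inner g (?B *v (A *v u)) - t * inner g u = inner g g"
        by (simp add: g_def[of] inner_diff_right)
      finally show ?thesis by (simp add: power2_norm_eq_inner)
    qed
    \<comment> \<open>At \<open>s = - c\<close> the quadratic equals
      \<open>- (c\<^sup>2 * (K + 2))\<close>; the summand 1 keeps the denominator positive when
      \<open>K = 0\<close>.\<close>
    define c where "c = (norm g)\<^sup>2 / (K + 1)"
    have c: "(norm g)\<^sup>2 = c * (K + 1)" using K by (simp add: c_def)
    have "0 \<le> - (c\<^sup>2 * (K + 2))"
      using quad[of "- c"] unfolding c by (simp add: power2_eq_square algebra_simps)
    hence "c = 0" using K by (smt (verit) mult_pos_pos zero_less_power2)
    thus ?thesis using c by simp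
  qed
  hence "(?B ** A) *v u = complex_of_real t *s u"
    by (simp add: g_def matrix_vector_mul_assoc of_real_vector_scalar_mult)
  moreover have "u \<noteq> 0" using u(1) by auto
  ultimately have tE: "t \<in> {t. t > 0 \<and> eigenvalue (?B ** A) (complex_of_real t)}"
    using tpos by (auto simp: eigenvalue_def)
  note fin = finite_positive_eigenvalues_gram[of A]
  show "lam > 0"
    using Min_in[OF fin] tE unfolding lam_def lambda_min_def by blast
  have "lam \<le> t"
    unfolding lam_def lambda_min_def using fin tE by (rule Min_le)
  thus "lam * (norm v)\<^sup>2 \<le> (norm (A *v v))\<^sup>2" if "v \<in> ?V"
    using ray[OF that] by (meson mult_right_mono order_trans zero_le_power2)
qed

section \<open>One step of the greedy Kaczmarz method\<close>

lemma residual_eq: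
  fixes A :: "complex^'n^'m"
  assumes "A *v p = b"
  shows "residual A b x = - (A *v (x - p))"
  using assms by (simp add: residual_def matrix_vector_mult_diff_distrib)

text \<open>This form of the update direction keeps the iterates in the row space.\<close>

lemma conj_row_in_row_space:
  fixes A :: "complex^'n^'m"
  shows "c *s (\<chi> j. cnj (row i A $ j)) = conj_transpose A *v axis i c"
  by (simp add: vec_eq_iff matrix_vector_mult_def axis_def row_def conj_transpose_def
      if_distrib cong: if_cong)

lemma kaczmarz_step:
  fixes A :: "complex^'n^'m" and i :: 'm
  assumes p: "A *v p = b"
    and x': "x' = x + (residual A b x $ i / complex_of_real ((norm (row i A))\<^sup>2))
      *s (\<chi> j. cnj (row i A $ j))"
  shows "(norm (x' - p))\<^sup>2 = (norm (x - p))\<^sup>2 - (cmod (residual A b x $ i))\<^sup>2 / (norm (row i A))\<^sup>2"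
    and "residual A b x' $ i = 0"
proof -
  define r N a where "r = residual A b x $ i" and "N = (norm (row i A))\<^sup>2"
    and "a = (\<chi> j. cnj (row i A $ j))"
  define c where "c = r / complex_of_real N"
  have x'a: "x' - p = (x - p) + c *s a"
    by (simp add: x' c_def r_def N_def a_def)
  have Ae: "(A *v (x - p)) $ i = - r"
    by (simp add: r_def residual_eq[OF p])
  have N: "N = (norm a)\<^sup>2"
    by (simp add: N_def a_def power2_norm_eq_inner inner_vec_def inner_complex_def)
  have "inner (x - p) (c *s a) = inner (A *v (x - p)) (axis i c)"
    by (simp add: a_def conj_row_in_row_space inner_matrix_vector_mult)
  also have "\<dots> = - inner r c"
    by (simp add: inner_axis Ae)
  \<comment> \<open>For a zero row both \<open>c\<close> and the quotient are 0, so this identity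
    and the next one hold without a case split.\<close>
  also have "inner r c = (cmod r)\<^sup>2 / N"
  proof -
    have "c = (1 / N) *\<^sub>R r" by (simp add: c_def scaleR_conv_of_real)
    thus ?thesis by (simp add: power2_norm_eq_inner)
  qed
  finally have cross: "inner (x - p) (c *s a) = - ((cmod r)\<^sup>2 / N)" .
  have "(norm (c *s a))\<^sup>2 = (cmod c)\<^sup>2 * N"
    by (simp add: N norm_vec_def L2_set_def sum_nonneg norm_mult power_mult_distrib
        sum_distrib_left)
  also have "\<dots> = (cmod r)\<^sup>2 / N"
    by (simp add: c_def norm_divide power_divide power2_eq_square)
  finally have sq: "(norm (c *s a))\<^sup>2 = (cmod r)\<^sup>2 / N" .
  show "(norm (x' - p))\<^sup>2 = (norm (x - p))\<^sup>2 - (cmod (residual A b x $ i))\<^sup>2 / (norm (row i A))\<^sup>2"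
    using cross sq unfolding x'a r_def[symmetric] N_def[symmetric]
    by (simp add: power2_norm_eq_inner inner_add inner_commute)
  have "(A *v a) $ i = (\<Sum>j\<in>UNIV. complex_of_real ((cmod (row i A $ j))\<^sup>2))"
    by (simp add: a_def matrix_vector_mult_def row_def complex_norm_square[symmetric])
  also have "\<dots> = complex_of_real N"
    by (simp add: N_def norm_vec_def L2_set_def sum_nonneg)
  finally have Aa: "(A *v a) $ i = complex_of_real N" .
  show "residual A b x' $ i = 0"
  proof (cases "N = 0")
    \<comment> \<open>A zero row contributes a zero residual entry at every point, because
      \<open>p\<close> solves the system.\<close>
    case True
    hence "row i A = 0" by (simp add: N_def)
    hence "(A *v v) $ i = 0" for v
      by (simp add: matrix_vector_mult_def row_def vec_eq_iff)
    thus ?thesis by (simp add: residual_eq[OF p])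
  next
    case False
    have "residual A b x' $ i = - ((A *v (x - p)) $ i + c * (A *v a) $ i)"
      unfolding residual_eq[OF p] x'a
      by (simp add: matrix_vector_right_distrib vector_scalar_commute)
    thus ?thesis using False by (simp add: Ae Aa c_def)
  qed
qed

lemma max_residual_set_ge:
  assumes "i \<in> max_residual_set A b x"
  shows "cmod (residual A b x $ j) \<le> cmod (residual A b x $ i)"
  using assms by (simp add: max_residual_set_def)

text \<open>Only entries in \<open>J\<close> contribute, each at most the maximal one.
  \<open>J\<close> is the whole index set in general and omits the previously selected index from
  the second step on.\<close>

lemma norm_residual_le:
  fixes A :: "complex^'n^'m"
  assumes "i \<in> max_residual_set A b x" and "\<And>j. j \<notin> J \<Longrightarrow> residual A b x $ j = 0"
  shows "(norm (residual A b x))\<^sup>2 \<le> real (card J) * (cmod (residual A b x $ i))\<^sup>2"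
proof -
  let ?r = "residual A b x"
  have "(norm ?r)\<^sup>2 = (\<Sum>j\<in>UNIV. (cmod (?r $ j))\<^sup>2)"
    by (simp add: norm_vec_def L2_set_def sum_nonneg)
  also have "\<dots> = (\<Sum>j\<in>J. (cmod (?r $ j))\<^sup>2)"
    by (rule sum.mono_neutral_right) (auto simp: assms(2))
  also have "\<dots> \<le> (\<Sum>j\<in>J. (cmod (?r $ i))\<^sup>2)"
    by (intro sum_mono power_mono max_residual_set_ge[OF assms(1)]) auto
  finally show ?thesis by simp
qed

text \<open>The exact decrease of the squared error is bounded below by enlarging the selected row
  norm to the sum over \<open>R\<close>, using \<open>1 / card R \<le> 1\<close>, and applying the
  eigenvalue bound to \<open>rc\<close>. The constant \<open>c\<close> will be \<open>m\<close> or
  \<open>m - 1\<close>.\<close>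

lemma GK_step_bound:
  fixes A :: "complex^'n^'m" and x :: "complex^'n"
  assumes R: "R = max_residual_set A b x"
    and lam: "lam = lambda_min (conj_transpose A ** A)"
    and A: "A \<noteq> 0" and p: "A *v p = b"
    and e: "x - p \<in> range (\<lambda>y. conj_transpose A *v y)"
    and i: "i \<in> R" and c: "c \<ge> 0"
    and rc: "(norm (residual A b x))\<^sup>2 \<le> c * (cmod (residual A b x $ i))\<^sup>2"
    and x': "x' = x + (residual A b x $ i / complex_of_real ((norm (row i A))\<^sup>2))
      *s (\<chi> j. cnj (row i A $ j))"
  shows "(norm (x' - p))\<^sup>2 \<le>
    (1 - 1 / real (card R) * (1 / (\<Sum>i\<in>R. (norm (row i A))\<^sup>2)) * (1 / c) * lam) * (norm (x - p))\<^sup>2"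
proof -
  define M N S where "M = (cmod (residual A b x $ i))\<^sup>2" and "N = (norm (row i A))\<^sup>2"
    and "S = (\<Sum>i\<in>R. (norm (row i A))\<^sup>2)"
  have S: "S \<ge> 0" by (simp add: S_def sum_nonneg)
  have "N \<le> S" unfolding N_def S_def by (rule member_le_sum) (use i in auto)
  have "lam * (norm (x - p))\<^sup>2 \<le> (norm (residual A b x))\<^sup>2"
    using lambda_min_gram(2)[OF A e] by (simp add: lam residual_eq[OF p])
  with rc have "lam * (norm (x - p))\<^sup>2 \<le> c * M" by (simp add: M_def)
  \<comment> \<open>For \<open>c = 0\<close> the left side is 0 by the convention
    \<open>1 / 0 = 0\<close>.\<close>
  hence 1: "1 / c * (lam * (norm (x - p))\<^sup>2) \<le> M"
    using c by (cases "c = 0") (auto simp: field_simps M_def)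
  have MN: "M / S \<le> M / N"
  proof (cases "N = 0")
    case True
    hence "row i A = 0" by (simp add: N_def)
    hence "M = 0"
      by (simp add: M_def residual_eq[OF p] matrix_vector_mult_def row_def vec_eq_iff)
    thus ?thesis by simp
  next
    case False
    hence "N > 0" by (simp add: N_def)
    thus ?thesis using \<open>N \<le> S\<close> by (intro divide_left_mono) (auto simp: M_def)
  qed
  have card: "1 / real (card R) \<le> 1"
  proof -
    have "card R > 0" using i by (auto simp: card_gt_0_iff)
    thus ?thesis by simp
  qed
  have "1 / real (card R) * (1 / S) * (1 / c) * lam * (norm (x - p))\<^sup>2
      = 1 / real (card R) * (1 / S) * (1 / c * (lam * (norm (x - p))\<^sup>2))"
    by simp
  also have "\<dots> \<le> 1 / real (card R) * (1 / S) * M"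
    using S by (intro mult_left_mono 1) auto
  also have "\<dots> \<le> 1 * (1 / S) * M"
    using S card by (intro mult_right_mono) (auto simp: M_def)
  also have "\<dots> \<le> M / N" using MN by simp
  finally show ?thesis
    using kaczmarz_step(1)[OF p x'] unfolding M_def N_def S_def by (simp add: algebra_simps)
qed

text \<open>The eigenvalue bound is tested on a conjugated nonzero row, with Cauchy-Schwarz applied
  to each row of \<open>A\<close>.\<close>

lemma lambda_min_gram_le:
  fixes A :: "complex^'n^'m"
  assumes "A \<noteq> 0"
  shows "lambda_min (conj_transpose A ** A) \<le> (\<Sum>i\<in>UNIV. (norm (row i A))\<^sup>2)"
proof -
  obtain i where i: "row i A \<noteq> 0"
    using assms by (auto simp: row_def vec_eq_iff)
  define v where "v = (\<chi> j. cnj (row i A $ j))"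
  have v: "v \<in> range (\<lambda>y. conj_transpose A *v y)"
    using conj_row_in_row_space[of 1 i A] by (simp add: v_def)
  have v0: "v \<noteq> 0" using i by (simp add: v_def vec_eq_iff)
  have row: "(cmod ((A *v v) $ k))\<^sup>2 \<le> (norm (row k A))\<^sup>2 * (norm v)\<^sup>2" for k
  proof -
    have "cmod ((A *v v) $ k) \<le> (\<Sum>j\<in>UNIV. \<bar>cmod (row k A $ j)\<bar> * \<bar>cmod (v $ j)\<bar>)"
      by (auto simp: matrix_vector_mult_def row_def norm_mult intro!: order_trans[OF norm_sum])
    also have "\<dots> \<le> norm (row k A) * norm v"
      unfolding norm_vec_def by (rule L2_set_mult_ineq)
    finally show ?thesis by (metis norm_ge_zero power_mono power_mult_distrib)
  qed
  have "lambda_min (conj_transpose A ** A) * (norm v)\<^sup>2 \<le> (norm (A *v v))\<^sup>2"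
    by (rule lambda_min_gram(2)[OF assms v])
  also have "\<dots> = (\<Sum>k\<in>UNIV. (cmod ((A *v v) $ k))\<^sup>2)"
    by (simp add: norm_vec_def L2_set_def sum_nonneg)
  also have "\<dots> \<le> (\<Sum>k\<in>UNIV. (norm (row k A))\<^sup>2) * (norm v)\<^sup>2"
    unfolding sum_distrib_right by (intro sum_mono row)
  finally show ?thesis using v0 by simp
qed

lemma converges_linearlyI:
  fixes x :: "nat \<Rightarrow> 'a::real_normed_vector"
  assumes "q < 1" and step: "\<And>k. (norm (x (Suc k) - l))\<^sup>2 \<le> q * (norm (x k - l))\<^sup>2"
  shows "converges_linearly x l"
proof -
  \<comment> \<open>\<open>max 0 q\<close> keeps the rate nonnegative when \<open>q\<close> is
    negative.\<close>
  define \<rho> where "\<rho> = sqrt (max 0 q)"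
  have \<rho>: "0 \<le> \<rho>" "\<rho> < 1" using assms(1) by (auto simp: \<rho>_def)
  have le: "norm (x (Suc k) - l) \<le> \<rho> * norm (x k - l)" for k
  proof (rule power2_le_imp_le)
    have "q * (norm (x k - l))\<^sup>2 \<le> max 0 q * (norm (x k - l))\<^sup>2"
      by (intro mult_right_mono) auto
    with step[of k] show "(norm (x (Suc k) - l))\<^sup>2 \<le> (\<rho> * norm (x k - l))\<^sup>2"
      by (simp add: \<rho>_def power_mult_distrib)
  qed (use \<rho> in simp)
  have pow: "norm (x k - l) \<le> \<rho> ^ k * norm (x 0 - l)" for k
  proof (induction k)
    case (Suc k)
    have "norm (x (Suc k) - l) \<le> \<rho> * (\<rho> ^ k * norm (x 0 - l))"
      using le[of k] mult_left_mono[OF Suc \<rho>(1)] by linarith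
    thus ?case by (simp add: mult.assoc)
  qed simp
  have "(\<lambda>k. \<rho> ^ k * norm (x 0 - l)) \<longlonglongrightarrow> 0"
    using \<rho> by (intro tendsto_mult_left_zero LIMSEQ_realpow_zero)
  hence "(\<lambda>k. x k - l) \<longlonglongrightarrow> 0"
    by (rule Lim_null_comparison[rotated]) (use pow in simp)
  hence "x \<longlonglongrightarrow> l" by (simp add: LIM_zero_iff)
  thus ?thesis using \<rho> le unfolding converges_linearly_def by blast
qed

theorem theorem3p4:
  fixes A :: "complex^'n^'m" and b :: "complex^'m"
    and x :: "nat \<Rightarrow> complex^'n" and idx :: "nat \<Rightarrow> 'm"
    and xs :: "complex^'n" and R :: "nat \<Rightarrow> 'm set"
    and m lam \<alpha> \<beta> :: real
  assumes consistent: "\<exists>z. A *v z = b"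
    and x0: "x 0 \<in> range (\<lambda>y. conj_transpose A *v y)"
    and GK: "GK_iteration A b x idx"
    and xs: "xs = pseudoinverse A *v b"
    and m: "m = real CARD('m)"
    and lam: "lam = lambda_min (conj_transpose A ** A)"
    and R: "\<And>k. R k = max_residual_set A b (x k)"
    and alpha: "\<alpha> = Max (range (\<lambda>k. real (card (R k))))"
    and beta: "\<beta> = Max (range (\<lambda>k. \<Sum>i\<in>R k. (norm (row i A))\<^sup>2))"
  shows "(\<forall>z. is_arg_min norm (\<lambda>z. A *v z = b) z \<longleftrightarrow> z = xs)
    \<and> converges_linearly x xs
    \<and> (norm (x 1 - xs))\<^sup>2 \<le>
        (1 - 1 / real (card (R 0)) * (1 / (\<Sum>i\<in>R 0. (norm (row i A))\<^sup>2)) * (1 / m) * lam)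
          * (norm (x 0 - xs))\<^sup>2
    \<and> (\<forall>k\<ge>1. (norm (x (k + 1) - xs))\<^sup>2 \<le>
        (1 - 1 / real (card (R k)) * (1 / (\<Sum>i\<in>R k. (norm (row i A))\<^sup>2)) * (1 / (m - 1)) * lam)
          * (norm (x k - xs))\<^sup>2)
    \<and> (\<forall>k\<ge>1. (norm (x k - xs))\<^sup>2 \<le>
        (1 - lam / (\<alpha> * \<beta> * (m - 1))) ^ (k - 1)
          * (1 - lam / (real (card (R 0)) * (\<Sum>i\<in>R 0. (norm (row i A))\<^sup>2) * m))
          * (norm (x 0 - xs))\<^sup>2)"
proof -
  define e where "e k = (norm (x k - xs))\<^sup>2" for k
  define S where "S k = (\<Sum>i\<in>R k. (norm (row i A))\<^sup>2)" for k
  have solves: "A *v xs = b" using consistent pseudoinverse_solves xs by blast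
  let ?V = "range (\<lambda>y. conj_transpose A *v y)"
  have subV: "subspace ?V"
    by (rule linear_subspace_image[OF linear_complex_matrix_vector_mult subspace_UNIV])
  have idxR: "idx k \<in> R k" for k
    using GK unfolding GK_iteration_def is_arg_max_def R by blast
  have step: "x (Suc k) = x k +
      (residual A b (x k) $ idx k / complex_of_real ((norm (row (idx k) A))\<^sup>2))
        *s (\<chi> j. cnj (row (idx k) A $ j))" for k
    using GK unfolding GK_iteration_def by blast
  have xV: "x k \<in> ?V" for k
  proof (induction k)
    case (Suc k)
    show ?case
      unfolding step[of k] conj_row_in_row_space by (rule subspace_add[OF subV Suc]) simp
  qed (rule x0)
  have eV: "x k - xs \<in> ?V" for k
    using subspace_diff[OF subV xV] pseudoinverse_in_row_space[of A b] xs by blast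
  have mge: "m \<ge> 1" unfolding m by (simp add: Suc_leI)
  have cardR: "real (card (R k)) \<ge> 1" for k
  proof -
    have "card (R k) > 0" using idxR by (auto simp: card_gt_0_iff)
    thus ?thesis by simp
  qed
  have S0: "S k \<ge> 0" for k by (simp add: S_def sum_nonneg)

  \<comment> \<open>Contraction of the squared error in one step\<close>
  have step_m: "e (Suc k) \<le> (1 - 1 / real (card (R k)) * (1 / S k) * (1 / m) * lam) * e k"
    if "A \<noteq> 0" for k
    unfolding e_def S_def
  proof (rule GK_step_bound[OF R lam that solves eV idxR _ _ step])
    show "(norm (residual A b (x k)))\<^sup>2 \<le> m * (cmod (residual A b (x k) $ idx k))\<^sup>2"
      using norm_residual_le[of "idx k" A b "x k" UNIV] idxR R m by simp
  qed (use mge in simp)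
  have step_m1: "e (Suc k) \<le> (1 - 1 / real (card (R k)) * (1 / S k) * (1 / (m - 1)) * lam) * e k"
    if "A \<noteq> 0" "k \<ge> 1" for k
    unfolding e_def S_def
  proof (rule GK_step_bound[OF R lam that(1) solves eV idxR _ _ step])
    have "residual A b (x k) $ idx (k - 1) = 0"
      using kaczmarz_step(2)[OF solves step, of "k - 1"] that(2) by simp
    hence "(norm (residual A b (x k)))\<^sup>2
        \<le> real (card (UNIV - {idx (k - 1)})) * (cmod (residual A b (x k) $ idx k))\<^sup>2"
      using idxR R by (intro norm_residual_le) auto
    moreover have "real (card (UNIV - {idx (k - 1)})) = m - 1"
      using mge by (simp add: m card_Diff_singleton of_nat_diff)
    ultimately show "(norm (residual A b (x k)))\<^sup>2 \<le> (m - 1) * (cmod (residual A b (x k) $ idx k))\<^sup>2"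
      by simp
  qed (use mge in simp)
  have e0: "e k \<ge> 0" for k by (simp add: e_def)
  \<comment> \<open>For \<open>A = 0\<close> the value of \<open>lam\<close> is unspecified; the row
    space is trivial, so all errors vanish and every bound reads \<open>0 \<le> 0\<close>.\<close>
  have eA0: "e k = 0" if "A = 0" for k
    using eV[of k] that by (auto simp: e_def conj_transpose_def vec_eq_iff matrix_vector_mult_def)
  \<comment> \<open>There are only finitely many index sets, so both maxima over all
    \<open>k\<close> are attained.\<close>
  have finR: "finite (range (\<lambda>k. f (R k)))" for f :: "'m set \<Rightarrow> real"
    by (rule finite_subset[of _ "range f"]) auto
  have al: "real (card (R k)) \<le> \<alpha>" for k
    unfolding alpha by (rule Max_ge[OF finR]) simp
  have be: "S k \<le> \<beta>" for k
    unfolding beta S_def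
    by (rule Max_ge[OF finR[of "\<lambda>T. \<Sum>i\<in>T. (norm (row i A))\<^sup>2"]]) simp
  have lampos: "lam > 0" if "A \<noteq> 0"
    using lambda_min_gram(1)[OF that] lam by simp
  have Rzero: "R k = UNIV" if "e k = 0" for k
  proof -
    have "residual A b (x k) = 0" using that solves by (simp add: e_def residual_def)
    thus ?thesis by (auto simp: R max_residual_set_def image_def)
  qed
  \<comment> \<open>If \<open>S k = 0\<close>, the selected row is zero, so the maximal residual and
    then the error vanish; hence \<open>R k\<close> is the whole index set and
    \<open>A = 0\<close>.\<close>
  have Spos: "S k > 0" if "A \<noteq> 0" for k
  proof (rule ccontr)
    assume "\<not> S k > 0"
    hence "S k = 0" using S0[of k] by simp
    hence rows: "row i A = 0" if "i \<in> R k" for i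
      using that by (simp add: S_def sum_nonneg_eq_0_iff)
    hence "residual A b (x k) $ idx k = 0"
      using rows[OF idxR[of k]]
      by (simp add: residual_eq[OF solves] matrix_vector_mult_def row_def vec_eq_iff)
    hence "norm (A *v (x k - xs)) = 0"
      using norm_residual_le[of "idx k" A b "x k" UNIV] idxR R by (simp add: residual_eq[OF solves])
    hence "lam * e k \<le> 0"
      using lambda_min_gram(2)[OF \<open>A \<noteq> 0\<close> eV[of k]] lam by (simp add: e_def)
    hence "e k = 0" using lampos[OF \<open>A \<noteq> 0\<close>] e0[of k] by (simp add: mult_le_0_iff)
    hence "A = 0" using rows Rzero by (auto simp: row_def vec_eq_iff)
    thus False using \<open>A \<noteq> 0\<close> by simp
  qed
  have apos: "\<alpha> > 0" using al[of 0] cardR[of 0] by linarith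
  have bpos: "\<beta> > 0" if "A \<noteq> 0" using be[of 0] Spos[OF that, of 0] by linarith
  have ab: "lam / (\<alpha> * \<beta> * c) \<le> 1 / real (card (R k)) * (1 / S k) * (1 / c) * lam"
    if "A \<noteq> 0" "c \<ge> 0" for k c
  proof (cases "c = 0")
    case False
    have "real (card (R k)) * S k * c \<le> \<alpha> * \<beta> * c"
      using al be S0 that(2) cardR[of k] by (intro mult_right_mono mult_mono) (auto intro: order_trans[OF _ al])
    hence "lam / (\<alpha> * \<beta> * c) \<le> lam / (real (card (R k)) * S k * c)"
      using lampos[OF that(1)] Spos[OF that(1), of k] cardR[of k] False that(2)
        apos bpos[OF that(1)] by (intro divide_left_mono mult_pos_pos) auto
    thus ?thesis by simp
  qed simp

  \<comment> \<open>Linear convergence\<close>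
  have conv: "converges_linearly x xs"
  proof (cases "A = 0")
    case True
    show ?thesis by (rule converges_linearlyI[of 0]) (use eA0[OF True] in \<open>auto simp: e_def\<close>)
  next
    case False
    show ?thesis
    proof (rule converges_linearlyI)
      \<comment> \<open>The rate uses \<open>m\<close> instead of \<open>m - 1\<close> so that it
        also covers step 0.\<close>
      show "1 - lam / (\<alpha> * \<beta> * m) < 1"
        using lampos[OF False] apos bpos[OF False] mge by simp
      fix k
      have "e (Suc k) \<le> (1 - lam / (\<alpha> * \<beta> * m)) * e k"
        using step_m[OF False, of k] ab[OF False, of m k] mge e0[of k]
        by (smt (verit) mult_right_mono)
      thus "(norm (x (Suc k) - xs))\<^sup>2 \<le> (1 - lam / (\<alpha> * \<beta> * m)) * (norm (x k - xs))\<^sup>2"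
        by (simp add: e_def)
    qed
  qed

  \<comment> \<open>Bound after \<open>k\<close> steps\<close>
  define q where "q = 1 - lam / (\<alpha> * \<beta> * (m - 1))"
  have one: "e 1 \<le> (1 - 1 / real (card (R 0)) * (1 / S 0) * (1 / m) * lam) * e 0"
    using step_m[of 0] eA0 by (cases "A = 0") simp_all
  have two: "e (k + 1) \<le> (1 - 1 / real (card (R k)) * (1 / S k) * (1 / (m - 1)) * lam) * e k"
    if "k \<ge> 1" for k
    using step_m1[of k] eA0 that by (cases "A = 0") simp_all
  have three: "e k \<le> q ^ (k - 1) * (1 - lam / (real (card (R 0)) * S 0 * m)) * e 0"
    if "k \<ge> 1" for k
  proof (cases "A = 0")
    case False
    have qstep: "e (Suc j) \<le> q * e j" if "j \<ge> 1" for j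
      using step_m1[OF False that] ab[OF False, of "m - 1" j] mge e0[of j]
      unfolding q_def by (smt (verit) mult_right_mono)
    \<comment> \<open>Nonnegativity is needed to chain the step inequalities.\<close>
    have q: "q \<ge> 0"
    proof (cases "e 1 = 0")
      case True
      \<comment> \<open>Once the iteration has terminated, all residual entries are maximal, so \<open>\<beta>\<close> is
        the squared Frobenius norm of \<open>A\<close>.\<close>
      have "lam \<le> \<beta>"
        using lambda_min_gram_le[OF False] be[of 1] Rzero[OF True] lam by (simp add: S_def)
      show ?thesis
      \<comment> \<open>For \<open>m = 1\<close> division by zero makes
        \<open>q = 1\<close>.\<close>
      proof (cases "m = 1")
        case False
        have "CARD('m) > 0" "CARD('m) \<noteq> 1" using False m by simp_all
        hence "CARD('m) \<ge> 2" by linarith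
        hence m2: "m - 1 \<ge> 1" using m by simp
        have a1: "\<alpha> \<ge> 1" using al[of 0] cardR[of 0] by linarith
        have b0: "\<beta> \<ge> 0" using be[of 0] S0[of 0] by linarith
        have "1 * \<beta> * 1 \<le> \<alpha> * \<beta> * (m - 1)"
          using a1 b0 m2 by (intro mult_mono) auto
        with \<open>lam \<le> \<beta>\<close> have "lam \<le> \<alpha> * \<beta> * (m - 1)" by simp
        thus ?thesis using apos bpos[OF \<open>A \<noteq> 0\<close>] m2 by (simp add: q_def divide_le_eq_1)
      qed (simp add: q_def)
    next
      case False
      \<comment> \<open>Here \<open>e 1 > 0\<close>, and \<open>0 \<le> e 2 \<le> q * e 1\<close>
        forces the sign of \<open>q\<close>.\<close>
      have "0 \<le> q * e 1" using qstep[of 1] e0[of "Suc 1"] by simp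
      thus ?thesis using False e0[of 1] by (simp add: zero_le_mult_iff)
    qed
    have "e (Suc j) \<le> q ^ j * e 1" for j
    proof (induction j)
      case (Suc j)
      have "e (Suc (Suc j)) \<le> q * (q ^ j * e 1)"
        using qstep[of "Suc j"] mult_left_mono[OF Suc q] by linarith
      thus ?case by (simp add: mult.assoc)
    qed simp
    from this[of "k - 1"] have "e k \<le> q ^ (k - 1) * e 1" using that by simp
    also have "\<dots> \<le> q ^ (k - 1) * ((1 - 1 / real (card (R 0)) * (1 / S 0) * (1 / m) * lam) * e 0)"
      using one q by (intro mult_left_mono) auto
    finally show ?thesis by (simp add: mult.assoc)
  qed (simp add: eA0)
  show ?thesis
    using conv one two three pseudoinverse_is_arg_min[OF consistent] xs
    unfolding e_def S_def q_def by blast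
qed

end
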